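(* There is a constant $c>0$ such that the following holds. For every sufficiently small $\epsilon<1$, every $f>0$, and every sufficiently large integer $n$ (depending on $\epsilon$), there exists a set of Uniform Facility Location instances $\{(V,d,f,\vec N)\}_{\vec N}$, where $(V,d)$ is the uniform star metric of size $n$ and radius $\sqrt{\epsilon}\,f$ and every instance in the set satisfies $n\le\|\vec N\|_1\le n/\epsilon$, such that no $\epsilon$-differentially private algorithm under the super-set output setting achieves expected multiplicative approximation ratio at most $c\cdot\frac{1}{\sqrt{\epsilon}}$ on all instances in the set.
   Context: Uniform Facility Location (UFL): an instance is a tuple $(V,d,f,\vec N)$, where $(V,d)$ is a finite metric, $f\ge 0$ is the facility cost, and $\vec N=(N_v)_{v\in V}\in\mathbb{Z}_{\ge0}^V$ gives the number of clients at each location. The cost of $S\subseteq V$ is $\mathrm{cost}_d(S;\vec N)=|S|\cdot f+\sum_{v\in V}N_v\, d(v,S)$, where $d(v,S)=\min_{s\in S}d(v,s)$; the goal is to minimize it. Super-set output setting: the algorithm outputs a set $R\subseteq V$; every client is connected to its nearest location in $R$, and the set $S\subseteq R$ of actually opened facilities is the set of locations in $R$ with at least one connected client; the cost of the solution is the cost of $S$. Differential privacy: a randomized algorithm $\mathcal{A}$ taking $\vec N$ as input is $\epsilon$-DP if for all $\vec N,\vec N'$ with $\|\vec N-\vec N'\|_1=1$ and every event $\mathcal{T}$ in the output space, $\Pr[\mathcal{A}(\vec N)\in\mathcal{T}]\le e^{\epsilon}\Pr[\mathcal{A}(\vec N')\in\mathcal{T}]$. The expected multiplicative approximation ratio on an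 instance is the expected cost of the algorithm's solution divided by the optimum cost. The uniform star metric of size $n$ and radius $r$ is the shortest-path metric of a star with one center and $n$ leaves (so $n+1$ points), all $n$ edges having length $r$. *)

theory Defs
  imports "HOL-Probability.Probability" "Graph_Theory.Shortest_Path"
begin

section \<open>The uniform star metric\<close>

text \<open>The centre is \<open>0\<close>, the leaves are \<open>1, \<dots>, n\<close>. Each undirected edge of the star is represented
  by its two opposite arcs.\<close>

definition star_points :: "nat \<Rightarrow> nat set" where
  "star_points n = {0..n}"

definition star_graph :: "nat \<Rightarrow> (nat, nat \<times> nat) pre_digraph" where
  "star_graph n = \<lparr> verts = star_points n,
                    arcs = {0} \<times> {1..n} \<union> {1..n} \<times> {0},
                    tail = fst, head = snd \<rparr>"

text \<open>The shortest-path metric when every edge has length \<open>r\<close>. The library's \<open>\<mu>\<close> is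
  extended-real-valued: it is \<open>\<infinity>\<close>, so that \<open>star_dist\<close> is \<open>0\<close>, if one of the points is not in the
  star.\<close>

definition star_dist :: "nat \<Rightarrow> real \<Rightarrow> nat \<Rightarrow> nat \<Rightarrow> real" where
  "star_dist n r u v = real_of_ereal (wf_digraph.\<mu> (star_graph n) (\<lambda>_. r) u v)"

lemma wf_star_graph: "wf_digraph (star_graph n)"
  by unfold_locales (auto simp: star_graph_def star_points_def)

lemma star_dist_eq:
  assumes "r > 0" "u \<in> star_points n" "v \<in> star_points n"
  shows "star_dist n r u v = (if u = v then 0 else if u = 0 \<or> v = 0 then r else 2 * r)"
proof -
  interpret wf_digraph "star_graph n" by (rule wf_star_graph)
  have cost: "awalk_cost (\<lambda>_. r) p = r * real (length p)" for p :: "(nat \<times> nat) list"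
    by (induction p) (auto simp: algebra_simps)
  define k :: nat where "k = (if u = v then 0 else if u = 0 \<or> v = 0 then 1 else 2)"
  define q where "q = (if u = v then [] else if u = 0 \<or> v = 0 then [(u, v)] else [(u, 0), (0, v)])"
  have sg: "verts (star_graph n) = star_points n"
    "arcs (star_graph n) = {0} \<times> {1..n} \<union> {1..n} \<times> {0}"
    "tail (star_graph n) = fst" "head (star_graph n) = snd"
    by (auto simp: star_graph_def)
  have q: "awalk u q v" "length q = k"
    using assms by (auto simp: q_def k_def awalk_def sg star_points_def)
  have min: "k \<le> length p" if "awalk u p v" for p
  proof -
    consider "p = []" | a where "p = [a]" | "length p \<ge> 2"
      by (cases p; cases "tl p") auto
    then show ?thesis
      using that by cases (auto simp: k_def awalk_def sg)
  qed
  have "\<mu> (\<lambda>_. r) u v = ereal (r * real k)"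
  proof (rule antisym)
    show "\<mu> (\<lambda>_. r) u v \<le> ereal (r * real k)"
      using min_cost_le_walk_cost[OF q(1), of "\<lambda>_. r"] by (simp add: cost q(2))
    show "ereal (r * real k) \<le> \<mu> (\<lambda>_. r) u v"
      unfolding \<mu>_def using min \<open>r > 0\<close> by (intro INF_greatest) (auto simp: cost)
  qed
  then show ?thesis
    by (auto simp: star_dist_def k_def)
qed

lemma star_dist_outside:
  assumes "u \<notin> star_points n \<or> v \<notin> star_points n"
  shows "star_dist n r u v = 0"
proof -
  interpret wf_digraph "star_graph n" by (rule wf_star_graph)
  have "{p. awalk u p v} = {}"
    using assms awalk_hd_in_verts awalk_last_in_verts by (fastforce simp: star_graph_def)
  then show ?thesis
    by (simp add: star_dist_def \<mu>_def top_ereal_def)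
qed

lemma Metric_space_star:
  assumes "r > 0"
  shows "Metric_space (star_points n) (star_dist n r)"
proof
  show "0 \<le> star_dist n r x y" for x y
    using assms by (cases "x \<in> star_points n \<and> y \<in> star_points n")
      (auto simp: star_dist_eq star_dist_outside)
  show "star_dist n r x y = star_dist n r y x" for x y
    using assms by (cases "x \<in> star_points n \<and> y \<in> star_points n")
      (auto simp: star_dist_eq star_dist_outside)
qed (use assms in \<open>auto simp: star_dist_eq\<close>)


section \<open>Uniform facility location\<close>

definition client_vectors :: "'v set \<Rightarrow> ('v \<Rightarrow> nat) set" where
  "client_vectors V = (V \<rightarrow>\<^sub>E UNIV)"

definition num_clients :: "'v set \<Rightarrow> ('v \<Rightarrow> nat) \<Rightarrow> nat" where
  "num_clients V N = (\<Sum>v\<in>V. N v)"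

text \<open>Values are in \<^typ>\<open>ennreal\<close>: the distance to the empty set is \<open>\<infinity>\<close>, so opening no facility has
  infinite cost as soon as there is a client (and cost \<open>0\<close> otherwise, since \<open>0 * \<infinity> = 0\<close>).\<close>

definition dist_to_set :: "('v \<Rightarrow> 'v \<Rightarrow> real) \<Rightarrow> 'v \<Rightarrow> 'v set \<Rightarrow> ennreal" where
  "dist_to_set d v S = (INF s\<in>S. ennreal (d v s))"

definition ufl_cost ::
  "'v set \<Rightarrow> ('v \<Rightarrow> 'v \<Rightarrow> real) \<Rightarrow> real \<Rightarrow> 'v set \<Rightarrow> ('v \<Rightarrow> nat) \<Rightarrow> ennreal" where
  "ufl_cost V d f S N =
     of_nat (card S) * ennreal f + (\<Sum>v\<in>V. of_nat (N v) * dist_to_set d v S)"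

definition ufl_opt :: "'v set \<Rightarrow> ('v \<Rightarrow> 'v \<Rightarrow> real) \<Rightarrow> real \<Rightarrow> ('v \<Rightarrow> nat) \<Rightarrow> ennreal" where
  "ufl_opt V d f N = (INF S\<in>Pow V. ufl_cost V d f S N)"


section \<open>The super-set output setting\<close>

text \<open>The \<open>i\<close>-th client at location \<open>v\<close> is the pair \<open>(v, i)\<close>.\<close>

definition clients :: "'v set \<Rightarrow> ('v \<Rightarrow> nat) \<Rightarrow> ('v \<times> nat) set" where
  "clients V N = (SIGMA v:V. {..<N v})"

text \<open>The nearest location in the output set \<open>R\<close> need not be unique. A connection rule resolves the
  ties; it may treat clients at the same location differently.\<close>

definition connection_rule ::
  "'v set \<Rightarrow> ('v \<Rightarrow> 'v \<Rightarrow> real) \<Rightarrow> (('v \<Rightarrow> nat) \<Rightarrow> 'v set \<Rightarrow> 'v \<times> nat \<Rightarrow> 'v) \<Rightarrow> bool" where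
  "connection_rule V d \<phi> \<longleftrightarrow>
     (\<forall>N\<in>client_vectors V. \<forall>R\<subseteq>V. R \<noteq> {} \<longrightarrow>
        (\<forall>c\<in>clients V N. is_arg_min (d (fst c)) (\<lambda>s. s \<in> R) (\<phi> N R c)))"

definition opened ::
  "'v set \<Rightarrow> (('v \<Rightarrow> nat) \<Rightarrow> 'v set \<Rightarrow> 'v \<times> nat \<Rightarrow> 'v) \<Rightarrow> ('v \<Rightarrow> nat) \<Rightarrow> 'v set \<Rightarrow> 'v set" where
  "opened V \<phi> N R = {s \<in> R. \<exists>c\<in>clients V N. \<phi> N R c = s}"

text \<open>Since there are only finitely many \<open>R \<subseteq> V\<close>, every output distribution is a \<open>pmf\<close>.\<close>

definition superset_algorithm :: "'v set \<Rightarrow> (('v \<Rightarrow> nat) \<Rightarrow> 'v set pmf) \<Rightarrow> bool" where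
  "superset_algorithm V A \<longleftrightarrow> (\<forall>N\<in>client_vectors V. set_pmf (A N) \<subseteq> Pow V)"

definition differentially_private :: "'v set \<Rightarrow> real \<Rightarrow> (('v \<Rightarrow> nat) \<Rightarrow> 'v set pmf) \<Rightarrow> bool" where
  "differentially_private V \<epsilon> A \<longleftrightarrow>
     (\<forall>N\<in>client_vectors V. \<forall>N'\<in>client_vectors V.
        (\<Sum>v\<in>V. \<bar>int (N v) - int (N' v)\<bar>) = 1 \<longrightarrow>
        (\<forall>T. measure_pmf.prob (A N) T \<le> exp \<epsilon> * measure_pmf.prob (A N') T))"

definition expected_ratio ::
  "'v set \<Rightarrow> ('v \<Rightarrow> 'v \<Rightarrow> real) \<Rightarrow> real \<Rightarrow> (('v \<Rightarrow> nat) \<Rightarrow> 'v set \<Rightarrow> 'v \<times> nat \<Rightarrow> 'v) \<Rightarrow>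
    (('v \<Rightarrow> nat) \<Rightarrow> 'v set pmf) \<Rightarrow> ('v \<Rightarrow> nat) \<Rightarrow> ennreal" where
  "expected_ratio V d f \<phi> A N =
     (\<integral>\<^sup>+ R. ufl_cost V d f (opened V \<phi> N R) N \<partial>measure_pmf (A N)) / ufl_opt V d f N"

end

theory Submission
  imports Defs
begin

text \<open>Put \<open>q = \<surd>\<epsilon>\<close> and give every leaf either one client or \<open>m = \<lfloor>1/\<epsilon>\<rfloor>\<close> clients. Opening a leaf costs
  \<open>f\<close>; not opening it costs at least \<open>q f\<close> or \<open>q f m \<approx> f / q\<close>, respectively, so a good
  solution opens the centre and the heavy leaves only. A heavy and a light leaf differ by fewer than
  \<open>1/\<epsilon>\<close> clients, so by privacy the probabilities of containing this leaf in the output differ by at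
  most a factor \<open>e\<close>. Make each leaf heavy independently with probability \<open>q\<close>. Then every leaf
  costs the algorithm \<open>\<Omega>(f)\<close> on average: either it is often opened while light, or it is often
  closed while heavy. It contributes only \<open>O(q f)\<close> to the expected optimum.\<close>

section \<open>Averaging over random subsets\<close>

text \<open>For \<open>H\<close> inside a finite \<open>L\<close> and \<open>q\<close> in [0,1],
  this is the probability of drawing \<open>H\<close> when each element of \<open>L\<close> is kept
  independently with probability \<open>q\<close>.\<close>

definition subset_weight :: "real \<Rightarrow> 'a set \<Rightarrow> 'a set \<Rightarrow> real" where
  "subset_weight q L H = q ^ card H * (1 - q) ^ card (L - H)"

text \<open>Conditioning on whether the random set contains \<open>i\<close>: the remainder is a
  random subset of \<open>L\<close> with the same \<open>q\<close>.\<close>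

lemma subset_weight_sum_insert:
  assumes "finite L" "i \<notin> L"
  shows "(\<Sum>H\<in>Pow (insert i L). subset_weight q (insert i L) H * t H) =
    (\<Sum>H\<in>Pow L. subset_weight q L H * ((1 - q) * t H + q * t (insert i H)))"
proof -
  have weight: "subset_weight q (insert i L) H = (1 - q) * subset_weight q L H"
    "subset_weight q (insert i L) (insert i H) = q * subset_weight q L H" if "H \<in> Pow L" for H
  proof -
    have "i \<notin> H" "finite H"
      using that assms by (auto intro: finite_subset)
    moreover have "insert i L - H = insert i (L - H)" "insert i L - insert i H = L - H"
      using \<open>i \<notin> H\<close> \<open>i \<notin> L\<close> by auto
    ultimately show "subset_weight q (insert i L) H = (1 - q) * subset_weight q L H"
      "subset_weight q (insert i L) (insert i H) = q * subset_weight q L H"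
      using assms by (simp_all add: subset_weight_def)
  qed
  have inj: "inj_on (insert i) (Pow L)"
    using \<open>i \<notin> L\<close> by (auto simp: inj_on_def)
  have "(\<Sum>H\<in>Pow (insert i L). subset_weight q (insert i L) H * t H) =
      (\<Sum>H\<in>Pow L. subset_weight q (insert i L) H * t H) +
      (\<Sum>H\<in>insert i ` Pow L. subset_weight q (insert i L) H * t H)"
    unfolding Pow_insert using assms by (intro sum.union_disjoint) auto
  also have "\<dots> = (\<Sum>H\<in>Pow L. subset_weight q L H * ((1 - q) * t H + q * t (insert i H)))"
    by (simp add: sum.reindex[OF inj] weight flip: sum.distrib)
       (simp add: algebra_simps)
  finally show ?thesis .
qed

lemma subset_weight_sum:
  assumes "finite L"
  shows "(\<Sum>H\<in>Pow L. subset_weight q L H) = 1"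
  using assms
proof (induction L)
  case empty
  then show ?case
    by (simp add: subset_weight_def)
next
  case (insert i L)
  then show ?case
    using subset_weight_sum_insert[of L i q "\<lambda>_. 1"] by simp
qed

text \<open>Probabilistic method. In \<open>avg\<close> only the membership of \<open>i\<close> is
  random and the rest of the set is fixed, so averaging over the rest bounds the mean of each
  \<open>u i\<close> from below by \<open>b\<close>. By linearity the sum has mean at least
  \<open>card L * b\<close>, and some set reaches its mean.\<close>

lemma exists_subset_sum_ge:
  fixes u :: "'a \<Rightarrow> 'a set \<Rightarrow> real"
  assumes "finite L" "0 \<le> q" "q \<le> 1"
    and avg: "\<And>i H. i \<in> L \<Longrightarrow> H \<subseteq> L - {i} \<Longrightarrow> b \<le> (1 - q) * u i H + q * u i (insert i H)"
  shows "\<exists>H\<subseteq>L. real (card L) * b \<le> (\<Sum>i\<in>L. u i H)"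
proof (rule ccontr)
  let ?w = "subset_weight q"
  have nonneg: "?w K H \<ge> 0" for K H :: "'a set"
    using assms by (simp add: subset_weight_def)
  have leaf: "b \<le> (\<Sum>H\<in>Pow L. ?w L H * u i H)" if "i \<in> L" for i
  proof -
    have L: "L = insert i (L - {i})"
      using that by auto
    have "b = (\<Sum>H\<in>Pow (L - {i}). ?w (L - {i}) H * b)"
      using assms by (simp add: subset_weight_sum flip: sum_distrib_right)
    also have "\<dots> \<le> (\<Sum>H\<in>Pow (L - {i}). ?w (L - {i}) H * ((1 - q) * u i H + q * u i (insert i H)))"
      using that by (intro sum_mono mult_left_mono avg nonneg) auto
    also have "\<dots> = (\<Sum>H\<in>Pow L. ?w L H * u i H)"
      using subset_weight_sum_insert[of "L - {i}" i q "u i"] assms L by simp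
    finally show ?thesis .
  qed
  assume "\<not> ?thesis"
  then have less: "(\<Sum>i\<in>L. u i H) < real (card L) * b" if "H \<in> Pow L" for H
    using that by (auto simp: not_le)
  \<comment> \<open>The averaged inequality is strict only if some set has positive weight; at
    \<open>q = 0\<close> or \<open>q = 1\<close> individual weights can vanish, but they still sum
    to 1.\<close>
  obtain K where K: "K \<in> Pow L" "?w L K > 0"
  proof -
    have "\<exists>K\<in>Pow L. ?w L K \<noteq> 0"
      using subset_weight_sum[OF assms(1), of q] by (metis sum.neutral zero_neq_one)
    then show ?thesis
      using that nonneg by (metis less_eq_real_def)
  qed
  have "real (card L) * b \<le> (\<Sum>i\<in>L. \<Sum>H\<in>Pow L. ?w L H * u i H)"
    using leaf by (intro sum_bounded_below)
  also have "\<dots> = (\<Sum>H\<in>Pow L. ?w L H * (\<Sum>i\<in>L. u i H))"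
    by (subst sum.swap) (simp add: sum_distrib_left)
  also have "\<dots> < (\<Sum>H\<in>Pow L. ?w L H * (real (card L) * b))"
  proof (rule sum_strict_mono_ex1)
    show "\<forall>H\<in>Pow L. ?w L H * (\<Sum>i\<in>L. u i H) \<le> ?w L H * (real (card L) * b)"
      using less by (intro ballI mult_left_mono nonneg less_imp_le)
    show "\<exists>H\<in>Pow L. ?w L H * (\<Sum>i\<in>L. u i H) < ?w L H * (real (card L) * b)"
      using K less by (intro bexI[of _ K] mult_strict_left_mono)
  qed (use assms(1) in simp)
  also have "\<dots> = real (card L) * b"
    using assms(1) by (simp add: subset_weight_sum flip: sum_distrib_right)
  finally show False
    by simp
qed

section \<open>Group privacy\<close>

text \<open>Adding \<open>k\<close> clients at one location is a walk through \<open>k\<close>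
  neighbouring inputs, each step costing a factor \<open>exp \<epsilon>\<close>.\<close>

lemma differentially_private_shift:
  assumes dp: "differentially_private V \<epsilon> A" and V: "finite V" "v \<in> V"
    and N: "N \<in> client_vectors V"
  shows "measure_pmf.prob (A (N(v := j + k))) T
    \<le> exp (\<epsilon> * real k) * measure_pmf.prob (A (N(v := j))) T"
proof (induction k)
  case 0
  then show ?case
    by simp
next
  case (Suc k)
  have cv: "N(v := l) \<in> client_vectors V" for l
    using N V by (auto simp: client_vectors_def PiE_iff extensional_def)
  have "(\<Sum>w\<in>V. \<bar>int ((N(v := j + Suc k)) w) - int ((N(v := j + k)) w)\<bar>) =
      (\<Sum>w\<in>V. if w = v then 1 else 0)"
    by (intro sum.cong) auto
  also have "\<dots> = 1"
    using V by simp
  finally have "measure_pmf.prob (A (N(v := j + Suc k))) T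
      \<le> exp \<epsilon> * measure_pmf.prob (A (N(v := j + k))) T"
    using dp cv unfolding differentially_private_def by blast
  also have "\<dots> \<le> exp \<epsilon> * (exp (\<epsilon> * real k) * measure_pmf.prob (A (N(v := j))) T)"
    by (intro mult_left_mono Suc.IH) simp
  also have "\<dots> = exp (\<epsilon> * real (Suc k)) * measure_pmf.prob (A (N(v := j))) T"
    by (simp add: algebra_simps flip: exp_add)
  finally show ?case .
qed

section \<open>Costs on the star\<close>

text \<open>\<open>H\<close> is meant to be the set of heavy leaves. The restriction to
  \<open>star_points n\<close> supplies the extensionality that \<open>client_vectors\<close>
  demands.\<close>

definition star_clients :: "nat \<Rightarrow> nat \<Rightarrow> nat set \<Rightarrow> nat \<Rightarrow> nat" where
  "star_clients n m H = (\<lambda>v\<in>star_points n. if v \<in> H then m else if v = 0 then 0 else 1)"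

lemma star_clients_in_client_vectors: "star_clients n m H \<in> client_vectors (star_points n)"
  by (auto simp: star_clients_def client_vectors_def)

lemma star_points_eq: "star_points n = insert 0 {1..n}"
  by (auto simp: star_points_def)

text \<open>Making a leaf heavy changes a single coordinate, which is the kind of change that group
  privacy handles.\<close>

lemma star_clients_upd:
  assumes "i \<in> {1..n}" "i \<notin> H"
  shows "(star_clients n m H)(i := 1) = star_clients n m H"
    and "(star_clients n m H)(i := m) = star_clients n m (insert i H)"
  using assms by (auto simp: star_clients_def star_points_def fun_eq_iff restrict_def)

lemma num_clients_star:
  assumes "H \<subseteq> {1..n}" "m \<ge> 1"
  shows "n \<le> num_clients (star_points n) (star_clients n m H)"
    and "num_clients (star_points n) (star_clients n m H) \<le> n * m"
proof -
  have eq: "num_clients (star_points n) (star_clients n m H) = (\<Sum>i\<in>{1..n}. if i \<in> H then m else 1)"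
    unfolding num_clients_def star_points_eq using assms
    by (auto simp: star_clients_def star_points_def intro!: sum.cong)
  show "n \<le> num_clients (star_points n) (star_clients n m H)"
    unfolding eq using assms sum_bounded_below[of "{1..n}" 1 "\<lambda>i. if i \<in> H then m else 1"] by auto
  show "num_clients (star_points n) (star_clients n m H) \<le> n * m"
    unfolding eq using assms sum_bounded_above[of "{1..n}" "\<lambda>i. if i \<in> H then m else 1" m] by auto
qed

text \<open>The witness opens the centre and the heavy leaves. The \<open>f\<close> outside the sum
  pays for the centre, from which each light leaf is served at cost \<open>r\<close>.\<close>

lemma ufl_opt_star_le:
  assumes r: "r > 0" and f: "f > 0" and H: "H \<subseteq> {1..n}"
  shows "ufl_opt (star_points n) (star_dist n r) f (star_clients n m H)
    \<le> ennreal (f + (\<Sum>i\<in>{1..n}. if i \<in> H then f else r))"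
proof -
  let ?V = "star_points n" and ?d = "star_dist n r" and ?N = "star_clients n m H"
  let ?S = "insert 0 H"
  have fin: "finite H" and zero: "0 \<notin> H"
    using H by (auto intro: finite_subset)
  have dist: "of_nat (?N i) * dist_to_set ?d i ?S \<le> ennreal (if i \<in> H then 0 else r)"
    if i: "i \<in> {1..n}" for i
  proof (cases "i \<in> H")
    case True
    have "dist_to_set ?d i ?S \<le> ennreal (?d i i)"
      unfolding dist_to_set_def using True by (intro INF_lower) auto
    also have "\<dots> = 0"
      using i r by (simp add: star_dist_eq star_points_def)
    finally show ?thesis
      using True by simp
  next
    case False
    have "dist_to_set ?d i ?S \<le> ennreal (?d i 0)"
      unfolding dist_to_set_def by (intro INF_lower) auto
    also have "\<dots> = ennreal r"
      using i r by (simp add: star_dist_eq star_points_def)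
    finally show ?thesis
      using False i by (simp add: star_clients_def star_points_def)
  qed
  have "ufl_opt ?V ?d f ?N \<le> ufl_cost ?V ?d f ?S ?N"
    unfolding ufl_opt_def using H by (intro INF_lower) (auto simp: star_points_def)
  also have "\<dots> = ennreal (f + card H * f) + (\<Sum>i\<in>{1..n}. of_nat (?N i) * dist_to_set ?d i ?S)"
  proof -
    have "?N 0 = 0"
      using zero by (simp add: star_clients_def star_points_def)
    moreover have "of_nat (card ?S) * ennreal f = ennreal (f + card H * f)"
      using f fin zero by (simp add: ennreal_of_nat_eq_real_of_nat distrib_right flip: ennreal_mult)
    ultimately show ?thesis
      unfolding ufl_cost_def star_points_eq by simp
  qed
  also have "\<dots> \<le> ennreal (f + card H * f) + (\<Sum>i\<in>{1..n}. ennreal (if i \<in> H then 0 else r))"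
    using dist by (intro add_left_mono sum_mono)
  also have "\<dots> = ennreal (f + card H * f + (\<Sum>i\<in>{1..n}. if i \<in> H then 0 else r))"
    using r f by (simp add: sum_nonneg flip: ennreal_plus)
  also have "card H * f = (\<Sum>i\<in>{1..n}. if i \<in> H then f else 0)"
    using H by (simp add: sum.If_cases Int_absorb1)
  also have "f + (\<Sum>i\<in>{1..n}. if i \<in> H then f else 0) + (\<Sum>i\<in>{1..n}. if i \<in> H then 0 else r)
      = f + (\<Sum>i\<in>{1..n}. if i \<in> H then f else r)"
    by (simp add: add.assoc flip: sum.distrib) (auto intro!: sum.cong)
  finally show ?thesis .
qed

text \<open>Every leaf has a client, and for a leaf in \<open>R\<close> the unique nearest point is
  the leaf itself. So it is opened under any tie-breaking, and a large superset is not free. Clients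
  of a leaf outside \<open>R\<close> travel at least one edge.\<close>

lemma ufl_cost_opened_star_ge:
  fixes H :: "nat set"
  assumes r: "r > 0" and f: "f > 0" and m: "m \<ge> 1"
    and \<phi>: "connection_rule (star_points n) (star_dist n r) \<phi>" and R: "R \<subseteq> star_points n"
  defines "N \<equiv> star_clients n m H"
  shows "(\<Sum>i\<in>{1..n}. ennreal (if i \<in> R then f else r * N i))
    \<le> ufl_cost (star_points n) (star_dist n r) f (opened (star_points n) \<phi> N R) N"
proof -
  let ?V = "star_points n" and ?d = "star_dist n r" and ?S = "opened (star_points n) \<phi> N R"
  have N: "N \<in> client_vectors ?V"
    unfolding N_def by (rule star_clients_in_client_vectors)
  have pos: "N i \<ge> 1" if "i \<in> {1..n}" for i
    using that m by (auto simp: N_def star_clients_def star_points_def)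
  have SR: "?S \<subseteq> R"
    by (auto simp: opened_def)
  have fin: "finite ?S"
    using SR R by (auto simp: star_points_def intro: finite_subset)
  have opened: "i \<in> ?S" if i: "i \<in> {1..n}" "i \<in> R" for i
  proof -
    have c: "(i, 0) \<in> clients ?V N"
      using i pos[of i] by (auto simp: clients_def star_points_def)
    moreover have "R \<noteq> {}"
      using i by auto
    ultimately have arg: "is_arg_min (?d i) (\<lambda>s. s \<in> R) (\<phi> N R (i, 0))"
      using \<phi>[unfolded connection_rule_def, rule_format, OF N R] by (metis fst_conv)
    have "\<phi> N R (i, 0) = i"
    proof (rule ccontr)
      assume ne: "\<phi> N R (i, 0) \<noteq> i"
      have "\<phi> N R (i, 0) \<in> ?V" "i \<in> ?V"
        using arg R i by (auto simp: is_arg_min_def)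
      then have "?d i i < ?d i (\<phi> N R (i, 0))"
        using ne r by (simp add: star_dist_eq)
      then show False
        using arg i by (auto simp: is_arg_min_def)
    qed
    then show ?thesis
      using c i unfolding opened_def by blast
  qed
  \<comment> \<open>This covers an empty \<open>?S\<close> as well, where the infimum is
    infinite.\<close>
  have dist: "ennreal r \<le> dist_to_set ?d i ?S" if i: "i \<in> {1..n}" "i \<notin> R" for i
    unfolding dist_to_set_def
  proof (intro INF_greatest ennreal_leI)
    fix s assume "s \<in> ?S"
    then have "s \<in> ?V" "i \<in> ?V" "s \<noteq> i"
      using SR R i by (auto simp: star_points_def)
    then show "r \<le> ?d i s"
      using r by (simp add: star_dist_eq)
  qed
  have "(\<Sum>i\<in>{1..n}. ennreal (if i \<in> R then f else r * N i)) =
      (\<Sum>i\<in>{1..n} \<inter> R. ennreal f) + (\<Sum>i\<in>{1..n} - R. ennreal (r * N i))"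
    by (simp add: if_distrib[of ennreal] sum.If_cases Diff_eq)
  also have "\<dots> \<le> of_nat (card ?S) * ennreal f + (\<Sum>v\<in>?V. of_nat (N v) * dist_to_set ?d v ?S)"
  proof (intro add_mono)
    \<comment> \<open>Only an inequality, since \<open>?S\<close> may also contain the
      centre.\<close>
    have "card ({1..n} \<inter> R) \<le> card ?S"
      using opened fin by (intro card_mono) auto
    then show "(\<Sum>i\<in>{1..n} \<inter> R. ennreal f) \<le> of_nat (card ?S) * ennreal f"
      by (simp add: mult_right_mono)
    have "(\<Sum>i\<in>{1..n} - R. ennreal (r * N i)) \<le> (\<Sum>i\<in>{1..n} - R. of_nat (N i) * dist_to_set ?d i ?S)"
    proof (intro sum_mono)
      fix i assume "i \<in> {1..n} - R"
      then have "of_nat (N i) * ennreal r \<le> of_nat (N i) * dist_to_set ?d i ?S"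
        using dist by (intro mult_left_mono) auto
      then show "ennreal (r * N i) \<le> of_nat (N i) * dist_to_set ?d i ?S"
        using r by (simp add: ennreal_of_nat_eq_real_of_nat ennreal_mult mult.commute)
    qed
    also have "\<dots> \<le> (\<Sum>v\<in>?V. of_nat (N v) * dist_to_set ?d v ?S)"
      by (intro sum_mono2) (auto simp: star_points_def)
    finally show "(\<Sum>i\<in>{1..n} - R. ennreal (r * N i)) \<le> (\<Sum>v\<in>?V. of_nat (N v) * dist_to_set ?d v ?S)" .
  qed
  finally show ?thesis
    by (simp add: ufl_cost_def)
qed

text \<open>By linearity of expectation only the marginals \<open>a i\<close> enter, so the bound
  splits into leaves however correlated their memberships in the output are.\<close>

lemma expected_cost_star_ge:
  fixes p :: "nat set pmf" and H :: "nat set"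
  assumes r: "r > 0" and f: "f > 0" and m: "m \<ge> 1"
    and \<phi>: "connection_rule (star_points n) (star_dist n r) \<phi>" and p: "set_pmf p \<subseteq> Pow (star_points n)"
  defines "N \<equiv> star_clients n m H" and "a \<equiv> \<lambda>i. measure_pmf.prob p {R. i \<in> R}"
  shows "ennreal (\<Sum>i\<in>{1..n}. f * a i + r * N i * (1 - a i))
    \<le> (\<integral>\<^sup>+ R. ufl_cost (star_points n) (star_dist n r) f (opened (star_points n) \<phi> N R) N \<partial>measure_pmf p)"
proof -
  have leaf: "(\<integral>\<^sup>+ R. ennreal (if i \<in> R then f else r * N i) \<partial>measure_pmf p) =
      ennreal (f * a i + r * N i * (1 - a i))" for i
  proof -
    have "(\<integral>\<^sup>+ R. ennreal (if i \<in> R then f else r * N i) \<partial>measure_pmf p) =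
        (\<integral>\<^sup>+ R. ennreal f * indicator {R. i \<in> R} R + ennreal (r * N i) * indicator (- {R. i \<in> R}) R
          \<partial>measure_pmf p)"
      by (intro nn_integral_cong) (auto simp: indicator_def)
    also have "\<dots> = ennreal f * ennreal (a i) + ennreal (r * N i) * ennreal (1 - a i)"
      using measure_pmf.prob_compl[of "{R. i \<in> R}" p]
      by (simp add: nn_integral_add nn_integral_cmult measure_pmf.emeasure_eq_measure a_def Compl_eq_Diff_UNIV)
    also have "\<dots> = ennreal (f * a i + r * N i * (1 - a i))"
      using r f by (simp add: a_def flip: ennreal_mult ennreal_plus)
    finally show ?thesis .
  qed
  have "ennreal (\<Sum>i\<in>{1..n}. f * a i + r * N i * (1 - a i)) =
      (\<Sum>i\<in>{1..n}. ennreal (f * a i + r * N i * (1 - a i)))"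
    using r f by (intro sum_ennreal[symmetric]) (simp add: a_def)
  also have "\<dots> = (\<integral>\<^sup>+ R. (\<Sum>i\<in>{1..n}. ennreal (if i \<in> R then f else r * N i)) \<partial>measure_pmf p)"
    by (simp add: leaf nn_integral_sum)
  also have "\<dots> \<le> (\<integral>\<^sup>+ R. ufl_cost (star_points n) (star_dist n r) f (opened (star_points n) \<phi> N R) N
      \<partial>measure_pmf p)"
    unfolding N_def using ufl_cost_opened_star_ge[OF r f m \<phi>] p
    by (intro nn_integral_mono_AE AE_pmfI) auto
  finally show ?thesis .
qed

section \<open>The lower bound\<close>

text \<open>The finiteness assumptions deal with the \<open>ennreal\<close> conventions: a nonzero
  \<open>x\<close> divided by 0 is infinite, and anything divided by infinity is 0.\<close>

lemma ennreal_le_mult_if_divide_le: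
  fixes x y c :: ennreal
  assumes "x / y \<le> c" "y \<noteq> \<top>" "c \<noteq> \<top>"
  shows "x \<le> c * y"
proof (cases "y = 0")
  case True
  then show ?thesis
    using assms by (cases "x = 0") (auto simp: ennreal_divide_zero top_unique)
next
  case False
  then have "x = x / y * y"
    using assms by (simp add: ennreal_divide_times ennreal_divide_self less_top)
  then show ?thesis
    using assms by (metis mult_right_mono zero_le)
qed

lemma superset_ratio_star_gt:
  assumes q: "0 < q" "q < 1 / 2" and f: "f > 0" and n: "1 \<le> q * real n"
    and A: "superset_algorithm (star_points n) A"
    and \<phi>: "connection_rule (star_points n) (star_dist n (q * f)) \<phi>"
    and dp: "differentially_private (star_points n) (q\<^sup>2) A"
    and m: "m \<ge> 1" "real m \<le> 1 / q\<^sup>2" "1 / q\<^sup>2 - 1 \<le> real m"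
  shows "\<exists>H\<subseteq>{1..n}. \<not> expected_ratio (star_points n) (star_dist n (q * f)) f \<phi> A (star_clients n m H)
    \<le> ennreal (1 / 20 * (1 / q))"
proof (rule ccontr)
  let ?N = "star_clients n m"
  define r where "r = q * f"
  define C where "C = 1 / 20 * (1 / q)"
  define a where "a i H = measure_pmf.prob (A (?N H)) {R. i \<in> R}" for i H
  \<comment> \<open>The expected cost of a leaf in excess of \<open>C\<close> times its share of the
    bound on the optimum. With the shares subtracted leaf by leaf, the ratio becomes a statement
    about a sum, to which averaging applies.\<close>
  define u where "u i H = f * a i H + r * ?N H i * (1 - a i H) - C * (if i \<in> H then f else r)" for i H
  have r: "r > 0" and C: "C > 0"
    using q f by (simp_all add: r_def C_def)
  have n1: "n \<ge> 1"
    using n by (cases n) auto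
  have a01: "0 \<le> a i H" "a i H \<le> 1" for i H
    by (simp_all add: a_def)
  assume "\<not> ?thesis"
  then have ratio: "expected_ratio (star_points n) (star_dist n r) f \<phi> A (?N H) \<le> ennreal C"
    if "H \<subseteq> {1..n}" for H
    using that by (simp add: r_def C_def)
  \<comment> \<open>The leaf shares of the optimum are already inside \<open>u\<close>, so only
    \<open>C\<close> times the fee of the centre remains.\<close>
  have upper: "(\<Sum>i\<in>{1..n}. u i H) \<le> C * f" if H: "H \<subseteq> {1..n}" for H
  proof -
    let ?opt = "f + (\<Sum>i\<in>{1..n}. if i \<in> H then f else r)"
    have opt: "ufl_opt (star_points n) (star_dist n r) f (?N H) \<le> ennreal ?opt"
      by (rule ufl_opt_star_le[OF r f H])
    have "set_pmf (A (?N H)) \<subseteq> Pow (star_points n)"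
      using A star_clients_in_client_vectors unfolding superset_algorithm_def by blast
    then have "ennreal (\<Sum>i\<in>{1..n}. f * a i H + r * ?N H i * (1 - a i H))
        \<le> (\<integral>\<^sup>+ R. ufl_cost (star_points n) (star_dist n r) f (opened (star_points n) \<phi> (?N H) R) (?N H)
            \<partial>measure_pmf (A (?N H)))"
      unfolding a_def using expected_cost_star_ge[OF r f m(1)] \<phi> by (simp add: r_def)
    also have "\<dots> \<le> ennreal C * ufl_opt (star_points n) (star_dist n r) f (?N H)"
      using ratio[OF H] opt unfolding expected_ratio_def
      by (intro ennreal_le_mult_if_divide_le) (auto simp: top_unique)
    also have "\<dots> \<le> ennreal C * ennreal ?opt"
      using opt by (rule mult_left_mono) simp
    also have "\<dots> = ennreal (C * ?opt)"
      using C r f by (simp add: ennreal_mult sum_nonneg)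
    finally have "(\<Sum>i\<in>{1..n}. f * a i H + r * ?N H i * (1 - a i H)) \<le> C * ?opt"
      using C r f by (subst (asm) ennreal_le_iff) (auto intro!: mult_nonneg_nonneg add_nonneg_nonneg sum_nonneg)
    then show ?thesis
      unfolding u_def sum_subtractf by (simp add: distrib_left flip: sum_distrib_left)
  qed
  \<comment> \<open>\<open>q * (r * m)\<close> is the connection cost of an unopened heavy leaf,
    weighted by the probability \<open>q\<close> of being heavy. It equals
    \<open>q\<^sup>2 * m * f\<close>, and rounding \<open>1 / q\<^sup>2\<close> down to
    \<open>m\<close> loses at most the factor \<open>1 - q\<^sup>2\<close>.\<close>
  have heavy: "f / 2 \<le> q * (r * m)"
  proof -
    have "1 / 2 \<le> 1 - q\<^sup>2"
      using q power_mono[of q "1/2" 2] by (simp add: power2_eq_square)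
    also have "\<dots> = q\<^sup>2 * (1 / q\<^sup>2 - 1)"
      using q by (simp add: field_simps)
    also have "\<dots> \<le> q\<^sup>2 * m"
      using m(3) by (intro mult_left_mono) auto
    finally show ?thesis
      using f mult_left_mono[of "1/2" "q\<^sup>2 * m" f] by (simp add: r_def power2_eq_square algebra_simps)
  qed
  \<comment> \<open>A light leaf becomes heavy by adding \<open>m - 1\<close> clients, and
    \<open>q\<^sup>2 * (m - 1)\<close> is at most 1.\<close>
  have privacy: "a i (insert i H) \<le> exp 1 * a i H" if "i \<in> {1..n}" "H \<subseteq> {1..n} - {i}" for i H
  proof -
    have "i \<notin> H" "i \<in> star_points n"
      using that by (auto simp: star_points_def)
    then have "a i (insert i H) \<le> exp (q\<^sup>2 * real (m - 1)) * a i H"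
      using differentially_private_shift[OF dp, of i "?N H" 1 "m - 1" "{R. i \<in> R}"]
        star_clients_in_client_vectors[of n m H] star_clients_upd[of i n H m] that m(1)
      by (simp add: a_def star_points_def)
    also have "\<dots> \<le> exp 1 * a i H"
    proof -
      have "q\<^sup>2 * real (m - 1) \<le> q\<^sup>2 * (1 / q\<^sup>2)"
        using m by (intro mult_left_mono) auto
      then show ?thesis
        using q a01 by (intro mult_right_mono) auto
    qed
    finally show ?thesis .
  qed
  \<comment> \<open>Each of the two cases subtracts at most \<open>C * r\<close>: a light leaf has
    share \<open>r\<close>, and a heavy one has share \<open>f\<close> with weight \<open>q\<close>,
    where \<open>q * f = r\<close>.\<close>
  have avg: "f / 6 - 2 * C * r \<le> (1 - q) * u i H + q * u i (insert i H)"
    if iH: "i \<in> {1..n}" "H \<subseteq> {1..n} - {i}" for i H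
  proof -
    have iV: "i \<in> star_points n" "i \<noteq> 0" "i \<notin> H"
      using iH by (auto simp: star_points_def)
    let ?a = "a i H" and ?b = "a i (insert i H)"
    have "?b \<le> 3 * ?a"
      using privacy[OF iH] exp_le mult_right_mono[of "exp 1" 3 ?a] a01(1)[of i H] by linarith
    \<comment> \<open>From \<open>?b \<le> 3 * ?a\<close> and \<open>?b \<le> 1\<close>:
      \<open>?a / 2 + (1 - ?b) / 2\<close> is at least \<open>1 / 2 - ?b / 3\<close>, hence at least
      1/6.\<close>
    then have "f / 6 \<le> f * (?a / 2) + f / 2 * (1 - ?b)"
      using f a01(1)[of i H] a01(2)[of i "insert i H"]
        mult_left_mono[of "1/6" "?a / 2 + 1 / 2 * (1 - ?b)" f] by (simp add: algebra_simps)
    also have "\<dots> \<le> (1 - q) * (f * ?a) + q * (r * m) * (1 - ?b)"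
      using q f a01 heavy mult_right_mono[of "1/2" "1 - q" "f * ?a"]
      by (intro add_mono mult_right_mono) (auto simp: algebra_simps)
    finally have cost: "f / 6 \<le> (1 - q) * (f * ?a) + q * (r * m) * (1 - ?b)" .
    \<comment> \<open>For the light leaf the connection cost is dropped, and for the heavy leaf
      below the opening cost.\<close>
    have "u i H \<ge> f * ?a - C * r"
      using iV r a01[of i H] by (simp add: u_def)
    then have light: "(1 - q) * u i H \<ge> (1 - q) * (f * ?a) - C * r"
      using q mult_left_mono[of "f * ?a - C * r" "u i H" "1 - q"] C r
      by (simp add: algebra_simps) (smt (verit) mult_nonneg_nonneg)
    have "u i (insert i H) \<ge> r * m * (1 - ?b) - C * f"
      using iV f a01[of i "insert i H"] by (simp add: u_def star_clients_def)
    then have "q * u i (insert i H) \<ge> q * (r * m) * (1 - ?b) - C * r"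
      using q mult_left_mono[of "r * m * (1 - ?b) - C * f" "u i (insert i H)" q]
      by (simp add: algebra_simps r_def)
    then show ?thesis
      using cost light by simp
  qed
  obtain H where H: "H \<subseteq> {1..n}" "real (card {1..n}) * (f / 6 - 2 * C * r) \<le> (\<Sum>i\<in>{1..n}. u i H)"
    using exists_subset_sum_ge[of "{1..n}" q "f / 6 - 2 * C * r" u] avg q by auto
  \<comment> \<open>The choice of \<open>C\<close> gives \<open>C * r = f / 20\<close>, so each leaf
    keeps \<open>f / 6 - f / 10 = f / 15\<close>. This beats the fee \<open>C * f\<close>, which is
    at most \<open>n * f / 20\<close> because \<open>1 \<le> q * n\<close>.\<close>
  have "real n * f / 15 = real (card {1..n}) * (f / 6 - 2 * C * r)"
    using q by (simp add: C_def r_def field_simps)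
  also note H(2)
  also note upper[OF H(1)]
  also have "C * f \<le> real n * f / 20"
    using n q f by (simp add: C_def field_simps)
  finally show False
    using f n1 by simp
qed

theorem theorem4:
  "\<exists>c::real. c > 0 \<and>
     (\<exists>\<epsilon>\<^sub>0::real. 0 < \<epsilon>\<^sub>0 \<and> \<epsilon>\<^sub>0 \<le> 1 \<and>
       (\<forall>\<epsilon>::real. 0 < \<epsilon> \<and> \<epsilon> < \<epsilon>\<^sub>0 \<longrightarrow>
         (\<exists>n\<^sub>0::nat. \<forall>f::real. \<forall>n::nat. f > 0 \<and> n \<ge> n\<^sub>0 \<longrightarrow>
           (let V = star_points n; d = star_dist n (sqrt \<epsilon> * f) in
            \<exists>I \<subseteq> client_vectors V.
              (\<forall>N\<in>I. n \<le> num_clients V N \<and> real (num_clients V N) \<le> real n / \<epsilon>) \<and>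
              \<not> (\<exists>A \<phi>. superset_algorithm V A \<and> connection_rule V d \<phi> \<and>
                   differentially_private V \<epsilon> A \<and>
                   (\<forall>N\<in>I. expected_ratio V d f \<phi> A N \<le> ennreal (c * (1 / sqrt \<epsilon>))))))))"
\<comment> \<open>The threshold 1/4 for \<epsilon> is what makes \<open>q = sqrt \<epsilon>\<close>
  smaller than 1/2.\<close>
proof (rule exI[of _ "1 / 20"], rule conjI, simp, rule exI[of _ "1 / 4"], intro conjI allI impI)
  fix \<epsilon> :: real
  assume "0 < \<epsilon> \<and> \<epsilon> < 1 / 4"
  then have \<epsilon>: "0 < \<epsilon>" "\<epsilon> < 1 / 4"
    by auto
  define q where "q = sqrt \<epsilon>"
  define m where "m = nat \<lfloor>1 / \<epsilon>\<rfloor>"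
  have sq: "\<epsilon> = q\<^sup>2"
    using \<epsilon> by (simp add: q_def)
  have q: "0 < q" "q < 1 / 2"
    using \<epsilon> real_sqrt_less_mono[of \<epsilon> "1 / 4"] by (simp_all add: q_def real_sqrt_divide)
  have "1 / \<epsilon> > 1"
    using \<epsilon> by simp
  then have m: "m \<ge> 1" "real m \<le> 1 / \<epsilon>" "1 / \<epsilon> - 1 \<le> real m"
    unfolding m_def by linarith+
  show "\<exists>n\<^sub>0::nat. \<forall>f::real. \<forall>n::nat. f > 0 \<and> n \<ge> n\<^sub>0 \<longrightarrow>
           (let V = star_points n; d = star_dist n (sqrt \<epsilon> * f) in
            \<exists>I \<subseteq> client_vectors V.
              (\<forall>N\<in>I. n \<le> num_clients V N \<and> real (num_clients V N) \<le> real n / \<epsilon>) \<and>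
              \<not> (\<exists>A \<phi>. superset_algorithm V A \<and> connection_rule V d \<phi> \<and>
                   differentially_private V \<epsilon> A \<and>
                   (\<forall>N\<in>I. expected_ratio V d f \<phi> A N \<le> ennreal (1 / 20 * (1 / sqrt \<epsilon>)))))"
  \<comment> \<open>This bound on \<open>n\<close> depends on \<epsilon> alone, as it is chosen
    before \<open>f\<close>.\<close>
  proof (intro exI[of _ "nat \<lceil>1 / q\<rceil>"] allI impI)
    fix f :: real and n :: nat
    assume fn: "f > 0 \<and> n \<ge> nat \<lceil>1 / q\<rceil>"
    then have "1 / q \<le> real n"
      by linarith
    then have n: "1 \<le> q * real n"
      using q by (simp add: field_simps)
    show "let V = star_points n; d = star_dist n (sqrt \<epsilon> * f) in
        \<exists>I \<subseteq> client_vectors V.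
          (\<forall>N\<in>I. n \<le> num_clients V N \<and> real (num_clients V N) \<le> real n / \<epsilon>) \<and>
          \<not> (\<exists>A \<phi>. superset_algorithm V A \<and> connection_rule V d \<phi> \<and>
               differentially_private V \<epsilon> A \<and>
               (\<forall>N\<in>I. expected_ratio V d f \<phi> A N \<le> ennreal (1 / 20 * (1 / sqrt \<epsilon>))))"
      unfolding Let_def
    \<comment> \<open>The family contains every choice of heavy leaves: it is fixed before the
      algorithm, while the bad \<open>H\<close> depends on \<open>A\<close> and
      \<open>\<phi>\<close>.\<close>
    proof (intro exI[of _ "star_clients n m ` Pow {1..n}"] conjI ballI)
      show "star_clients n m ` Pow {1..n} \<subseteq> client_vectors (star_points n)"
        using star_clients_in_client_vectors by auto
      show "\<not> (\<exists>A \<phi>. superset_algorithm (star_points n) A \<and>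
          connection_rule (star_points n) (star_dist n (sqrt \<epsilon> * f)) \<phi> \<and>
          differentially_private (star_points n) \<epsilon> A \<and>
          (\<forall>N\<in>star_clients n m ` Pow {1..n}.
            expected_ratio (star_points n) (star_dist n (sqrt \<epsilon> * f)) f \<phi> A N
              \<le> ennreal (1 / 20 * (1 / sqrt \<epsilon>))))"
        \<comment> \<open>The order matters: \<open>sqrt \<epsilon>\<close> is folded to
          \<open>q\<close> before the remaining \<epsilon> is rewritten as a square.\<close>
        using superset_ratio_star_gt[OF q _ n] fn m
        unfolding q_def[symmetric] unfolding sq by blast
      fix N
      assume "N \<in> star_clients n m ` Pow {1..n}"
      then obtain H where H: "H \<subseteq> {1..n}" "N = star_clients n m H"
        by auto
      show "n \<le> num_clients (star_points n) N"
        using num_clients_star[OF H(1) m(1)] H(2) by simp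
      have "real (num_clients (star_points n) N) \<le> real (n * m)"
        using num_clients_star[OF H(1) m(1)] H(2) by (simp only: of_nat_le_iff)
      also have "\<dots> \<le> real n / \<epsilon>"
        using m(2) mult_left_mono[of "real m" "1 / \<epsilon>" "real n"] by simp
      finally show "real (num_clients (star_points n) N) \<le> real n / \<epsilon>" .
    qed
  qed
qed simp_all

end
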